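(* Assume that $\lim_{|x|\to0}\frac{|Q(x)|}{|x|}=0$. Consider the semi-definite program in the decision variables $P_1\in\mathbb S^{n\times n}$, $Y_1\in\mathbb R^{T\times n}$, $G_2\in\mathbb R^{T\times(S-n)}$: minimize $\|X_1G_2\|$ (any norm) subject to $$Z_0Y_1=\begin{bmatrix}P_1\\ 0_{(S-n)\times n}\end{bmatrix},\qquad \begin{bmatrix}P_1&(X_1Y_1)^\top\\ X_1Y_1&P_1\end{bmatrix}\succ0,\qquad Z_0G_2=\begin{bmatrix}0_{n\times(S-n)}\\ I_{S-n}\end{bmatrix}.$$ If this program is feasible, then the control law $u=KZ(x)$ with $$K=U_0\begin{bmatrix}Y_1&G_2\end{bmatrix}\begin{bmatrix}P_1&0_{n\times(S-n)}\\ 0_{(S-n)\times n}&I_{S-n}\end{bmatrix}^{-1},$$ where $(P_1,Y_1,G_2)$ is any feasible point, renders the origin an asymptotically stable equilibrium of the closed-loop system $x^+=AZ(x)+BKZ(x)$.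
   Context: Let $n,m,S,T$ be positive integers with $S\ge n$ (blocks of zero size are absent when $S=n$). Consider the discrete-time system $x^+=AZ(x)+Bu$, i.e. $x(t+1)=AZ(x(t))+Bu(t)$, with $x\in\mathbb R^n$, $u\in\mathbb R^m$, constant matrices $A\in\mathbb R^{n\times S}$, $B\in\mathbb R^{n\times m}$ (unknown to the designer), and $Z(x)=\begin{bmatrix}x\\ Q(x)\end{bmatrix}$ with a known function $Q:\mathbb R^n\to\mathbb R^{S-n}$ containing only nonlinear functions. Data: samples $x(0),\dots,x(T)\in\mathbb R^n$, $u(0),\dots,u(T-1)\in\mathbb R^m$ satisfying $x(k+1)=AZ(x(k))+Bu(k)$ for $k=0,\dots,T-1$. Define $U_0=[u(0)\ \cdots\ u(T-1)]\in\mathbb R^{m\times T}$, $X_1=[x(1)\ \cdots\ x(T)]\in\mathbb R^{n\times T}$, $Z_0=[Z(x(0))\ \cdots\ Z(x(T-1))]\in\mathbb R^{S\times T}$. $\mathbb S^{n\times n}$ is the set of real symmetric $n\times n$ matrices; $\succ0$ means positive definite; $|\cdot|$ is the Euclidean norm.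
   Formalization: The formal theorem adds the assumption Q(0)=0 (equivalently, given the limit, continuity of Q at the origin); the limit of |Q(x)|/|x| does not constrain Q(0), and without this the origin need not be an equilibrium of the closed loop. *)

theory Defs
  imports Complex_Main "Jordan_Normal_Form.Gauss_Jordan_Elimination"
begin

(* Vectors and matrices are those of Jordan_Normal_Form, with dimensions that are natural
   numbers, because the dimension S - n of the nonlinear part may be zero. *)

definition euclid_norm :: "real vec \<Rightarrow> real" where
  "euclid_norm v = sqrt (v \<bullet> v)"

definition symmetric :: "nat \<Rightarrow> real mat \<Rightarrow> bool" where
  "symmetric d M \<longleftrightarrow> M \<in> carrier_mat d d \<and> M\<^sup>T = M"

definition pos_def :: "nat \<Rightarrow> real mat \<Rightarrow> bool" where
  "pos_def d M \<longleftrightarrow>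
     symmetric d M \<and> (\<forall>v \<in> carrier_vec d. v \<noteq> 0\<^sub>v d \<longrightarrow> v \<bullet> (M *\<^sub>v v) > 0)"

definition append_cols :: "real mat \<Rightarrow> real mat \<Rightarrow> real mat" where
  "append_cols M N = four_block_mat M N (0\<^sub>m 0 (dim_col M)) (0\<^sub>m 0 (dim_col N))"

(* x in R^n with |x| tending to 0, the origin excluded. A limit of |Q(x)|/|x| along this
   filter therefore does not constrain Q(0); given that limit, Q(0) = 0 amounts to
   continuity of Q at the origin. *)

definition small_state :: "nat \<Rightarrow> real vec filter" where
  "small_state n =
     inf (filtercomap euclid_norm (at_right 0)) (principal (carrier_vec n))"

definition lift_state :: "(real vec \<Rightarrow> real vec) \<Rightarrow> real vec \<Rightarrow> real vec" where
  "lift_state Q x = x @\<^sub>v Q x"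

definition open_loop ::
    "real mat \<Rightarrow> real mat \<Rightarrow> (real vec \<Rightarrow> real vec) \<Rightarrow> real vec \<Rightarrow> real vec \<Rightarrow> real vec" where
  "open_loop A B Q x u = A *\<^sub>v lift_state Q x + B *\<^sub>v u"

definition closed_loop ::
    "real mat \<Rightarrow> real mat \<Rightarrow> (real vec \<Rightarrow> real vec) \<Rightarrow> real mat \<Rightarrow> real vec \<Rightarrow> real vec" where
  "closed_loop A B Q K x = open_loop A B Q x (K *\<^sub>v lift_state Q x)"

(* u(0), ..., u(T-1);  x(1), ..., x(T);  Z(x(0)), ..., Z(x(T-1)) as columns *)

definition data_U0 :: "nat \<Rightarrow> nat \<Rightarrow> (nat \<Rightarrow> real vec) \<Rightarrow> real mat" where
  "data_U0 m T u = mat_of_cols m (map u [0..<T])"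

definition data_X1 :: "nat \<Rightarrow> nat \<Rightarrow> (nat \<Rightarrow> real vec) \<Rightarrow> real mat" where
  "data_X1 n T x = mat_of_cols n (map (\<lambda>k. x (k + 1)) [0..<T])"

definition data_Z0 ::
    "nat \<Rightarrow> nat \<Rightarrow> (real vec \<Rightarrow> real vec) \<Rightarrow> (nat \<Rightarrow> real vec) \<Rightarrow> real mat" where
  "data_Z0 S T Q x = mat_of_cols S (map (\<lambda>k. lift_state Q (x k)) [0..<T])"

(* Constraints of the semi-definite program. The objective, the norm of X1 * G2, does not
   affect which points are feasible. *)

definition sdp_feasible ::
    "nat \<Rightarrow> nat \<Rightarrow> nat \<Rightarrow> real mat \<Rightarrow> real mat \<Rightarrow> real mat \<Rightarrow> real mat \<Rightarrow> real mat \<Rightarrow> bool" where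
  "sdp_feasible n S T X1 Z0 P1 Y1 G2 \<longleftrightarrow>
     symmetric n P1 \<and> Y1 \<in> carrier_mat T n \<and> G2 \<in> carrier_mat T (S - n) \<and>
     Z0 * Y1 = P1 @\<^sub>r 0\<^sub>m (S - n) n \<and>
     pos_def (n + n) (four_block_mat P1 (X1 * Y1)\<^sup>T (X1 * Y1) P1) \<and>
     Z0 * G2 = 0\<^sub>m n (S - n) @\<^sub>r 1\<^sub>m (S - n)"

(* mat_inverse yields an option; for a feasible point P1 is positive definite, so the
   block-diagonal matrix is invertible. *)

definition sdp_gain ::
    "nat \<Rightarrow> nat \<Rightarrow> real mat \<Rightarrow> real mat \<Rightarrow> real mat \<Rightarrow> real mat \<Rightarrow> real mat" where
  "sdp_gain n S U0 P1 Y1 G2 =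
     U0 * append_cols Y1 G2 *
     the (mat_inverse
       (four_block_mat P1 (0\<^sub>m n (S - n)) (0\<^sub>m (S - n) n) (1\<^sub>m (S - n))))"

definition equilibrium :: "nat \<Rightarrow> (real vec \<Rightarrow> real vec) \<Rightarrow> real vec \<Rightarrow> bool" where
  "equilibrium n f xe \<longleftrightarrow> xe \<in> carrier_vec n \<and> f xe = xe"

definition lyapunov_stable :: "nat \<Rightarrow> (real vec \<Rightarrow> real vec) \<Rightarrow> real vec \<Rightarrow> bool" where
  "lyapunov_stable n f xe \<longleftrightarrow>
     (\<forall>\<epsilon>>0. \<exists>\<delta>>0. \<forall>x \<in> carrier_vec n. euclid_norm (x - xe) < \<delta> \<longrightarrow>
        (\<forall>t. euclid_norm ((f ^^ t) x - xe) < \<epsilon>))"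

definition locally_attractive :: "nat \<Rightarrow> (real vec \<Rightarrow> real vec) \<Rightarrow> real vec \<Rightarrow> bool" where
  "locally_attractive n f xe \<longleftrightarrow>
     (\<exists>\<delta>>0. \<forall>x \<in> carrier_vec n. euclid_norm (x - xe) < \<delta> \<longrightarrow>
        (\<lambda>t. euclid_norm ((f ^^ t) x - xe)) \<longlonglongrightarrow> 0)"

definition asymptotically_stable_equilibrium ::
    "nat \<Rightarrow> (real vec \<Rightarrow> real vec) \<Rightarrow> real vec \<Rightarrow> bool" where
  "asymptotically_stable_equilibrium n f xe \<longleftrightarrow>
     equilibrium n f xe \<and> lyapunov_stable n f xe \<and> locally_attractive n f xe"

end

theory Submission
  imports Defs "Jordan_Normal_Form.Determinant"
begin

text \<open>The data satisfy \<open>X1 = A Z0 + B U0\<close>, and the equality constraints give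
  \<open>Z0 (Y1 R v + G2 Q v) = lift_state Q v\<close> with \<open>R\<close> the inverse of \<open>P1\<close>. Hence the closed
  loop is \<open>v \<mapsto> X1 Y1 R v + X1 G2 Q v\<close>. The matrix inequality makes the linear part a strict
  contraction for the Lyapunov function \<open>v \<bullet> R v\<close>, and since \<open>Q v\<close> is \<open>o(|v|)\<close> the
  contraction survives the nonlinear part near the origin.\<close>

section \<open>Zero products and the Euclidean norm\<close>

lemma zero_mat_mult_vec [simp]:
  fixes v :: "'a :: semiring_0 vec"
  assumes "v \<in> carrier_vec q"
  shows "0\<^sub>m p q *\<^sub>v v = 0\<^sub>v p"
  using assms by (intro eq_vecI) auto

lemma mult_mat_zero_vec [simp]:
  fixes M :: "'a :: semiring_0 mat"
  assumes "M \<in> carrier_mat p q"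
  shows "M *\<^sub>v 0\<^sub>v q = 0\<^sub>v p"
  using assms by (intro eq_vecI) auto

lemma euclid_norm_nonneg [simp]: "0 \<le> euclid_norm v"
  by (simp add: euclid_norm_def scalar_prod_def sum_nonneg)

lemma euclid_norm_power2: "(euclid_norm v)\<^sup>2 = v \<bullet> v"
  by (simp add: euclid_norm_def scalar_prod_def sum_nonneg)

lemma euclid_norm_eq_0_iff:
  assumes "v \<in> carrier_vec d"
  shows "euclid_norm v = 0 \<longleftrightarrow> v = 0\<^sub>v d"
  using assms by (auto simp: euclid_norm_def scalar_prod_def sum_nonneg_eq_0_iff intro!: eq_vecI)

section \<open>Quadratic forms of symmetric and positive definite matrices\<close>

lemma symmetric_scalar_prod_commute:
  assumes M: "symmetric d M" and v: "v \<in> carrier_vec d" and w: "w \<in> carrier_vec d"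
  shows "v \<bullet> (M *\<^sub>v w) = w \<bullet> (M *\<^sub>v v)"
proof -
  have Mc: "M \<in> carrier_mat d d" and Mt: "M\<^sup>T = M"
    using M by (auto simp: symmetric_def)
  have "v \<bullet> (M *\<^sub>v w) = (M *\<^sub>v v) \<bullet> w"
    using transpose_vec_mult_scalar[OF Mc w v] Mt by simp
  also have "\<dots> = w \<bullet> (M *\<^sub>v v)"
    by (rule comm_scalar_prod[of _ d]) (use Mc v w in auto)
  finally show ?thesis .
qed

lemma pos_def_carrier: "pos_def d M \<Longrightarrow> M \<in> carrier_mat d d"
  by (simp add: pos_def_def symmetric_def)

lemma pos_def_quad_nonneg:
  assumes M: "pos_def d M" and v: "v \<in> carrier_vec d"
  shows "0 \<le> v \<bullet> (M *\<^sub>v v)"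
proof (cases "v = 0\<^sub>v d")
  case True
  then show ?thesis using pos_def_carrier[OF M] by auto
next
  case False
  then show ?thesis using M v by (auto simp: pos_def_def intro: less_imp_le)
qed

text \<open>Symmetry merges the two mixed terms into one. Different coefficients then serve
  Cauchy-Schwarz, the weighted splitting of a sum and its plain expansion.\<close>

lemma symmetric_quad_lincomb:
  assumes M: "symmetric d M" and v: "v \<in> carrier_vec d" and w: "w \<in> carrier_vec d"
  shows "(a \<cdot>\<^sub>v v + b \<cdot>\<^sub>v w) \<bullet> (M *\<^sub>v (a \<cdot>\<^sub>v v + b \<cdot>\<^sub>v w)) =
    a\<^sup>2 * (v \<bullet> (M *\<^sub>v v)) + 2 * a * b * (v \<bullet> (M *\<^sub>v w)) + b\<^sup>2 * (w \<bullet> (M *\<^sub>v w))"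
proof -
  have Mc: "M \<in> carrier_mat d d" using M by (simp add: symmetric_def)
  have Mv: "M *\<^sub>v v \<in> carrier_vec d" "M *\<^sub>v w \<in> carrier_vec d" using Mc v w by auto
  have "M *\<^sub>v (a \<cdot>\<^sub>v v + b \<cdot>\<^sub>v w) = a \<cdot>\<^sub>v (M *\<^sub>v v) + b \<cdot>\<^sub>v (M *\<^sub>v w)"
    using Mc v w by (simp add: mult_add_distrib_mat_vec[of _ d d] mult_mat_vec[of _ d d])
  then show ?thesis
    using v w Mv symmetric_scalar_prod_commute[OF M w v]
    by (simp add: add_scalar_prod_distrib[of _ d] scalar_prod_add_distrib[of _ d]
        algebra_simps power2_eq_square)
qed

text \<open>With \<open>p\<close> the form at \<open>w\<close> and \<open>t\<close> the mixed term,
  the form at \<open>p v - t w\<close> is nonnegative and equals \<open>p\<close> times the gap in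
  the inequality. Scaling \<open>v\<close> by \<open>p\<close> avoids quotients;
  \<open>p > 0\<close> is cancelled at the end.\<close>

lemma pos_def_Cauchy_Schwarz:
  assumes M: "pos_def d M" and v: "v \<in> carrier_vec d" and w: "w \<in> carrier_vec d"
  shows "(v \<bullet> (M *\<^sub>v w))\<^sup>2 \<le> (v \<bullet> (M *\<^sub>v v)) * (w \<bullet> (M *\<^sub>v w))"
proof (cases "w = 0\<^sub>v d")
  case True
  then have "M *\<^sub>v w = 0\<^sub>v d" using pos_def_carrier[OF M] by auto
  then show ?thesis using True v by simp
next
  case False
  let ?p = "w \<bullet> (M *\<^sub>v w)" and ?t = "v \<bullet> (M *\<^sub>v w)"
  have p: "?p > 0" using M w False by (auto simp: pos_def_def)
  have s: "symmetric d M" using M by (simp add: pos_def_def)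
  have "0 \<le> (?p \<cdot>\<^sub>v v + (- ?t) \<cdot>\<^sub>v w) \<bullet> (M *\<^sub>v (?p \<cdot>\<^sub>v v + (- ?t) \<cdot>\<^sub>v w))"
    using v w by (intro pos_def_quad_nonneg[OF M]) auto
  also have "\<dots> = ?p * ((v \<bullet> (M *\<^sub>v v)) * ?p - ?t\<^sup>2)"
    unfolding symmetric_quad_lincomb[OF s v w] by (simp add: algebra_simps power2_eq_square)
  finally show ?thesis using p by (simp add: zero_le_mult_iff)
qed

text \<open>Young's inequality: nonnegativity of the form at \<open>s v - w\<close>, divided by
  \<open>s\<close>, bounds the mixed term. A small weight \<open>s\<close> keeps the first
  coefficient close to 1, so that a strict contraction stays strict after a perturbation.\<close>

lemma pos_def_quad_add_le:
  assumes M: "pos_def d M" and v: "v \<in> carrier_vec d" and w: "w \<in> carrier_vec d" and s: "s > 0"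
  shows "(v + w) \<bullet> (M *\<^sub>v (v + w)) \<le> (1 + s) * (v \<bullet> (M *\<^sub>v v)) + (1 + 1 / s) * (w \<bullet> (M *\<^sub>v w))"
proof -
  have sy: "symmetric d M" using M by (simp add: pos_def_def)
  have "0 \<le> (s \<cdot>\<^sub>v v + (- 1) \<cdot>\<^sub>v w) \<bullet> (M *\<^sub>v (s \<cdot>\<^sub>v v + (- 1) \<cdot>\<^sub>v w))"
    using v w by (intro pos_def_quad_nonneg[OF M]) auto
  then have "0 \<le> s\<^sup>2 * (v \<bullet> (M *\<^sub>v v)) - 2 * s * (v \<bullet> (M *\<^sub>v w)) + w \<bullet> (M *\<^sub>v w)"
    unfolding symmetric_quad_lincomb[OF sy v w] by simp
  then have "2 * (v \<bullet> (M *\<^sub>v w)) \<le> s * (v \<bullet> (M *\<^sub>v v)) + (w \<bullet> (M *\<^sub>v w)) / s"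
    using s by (simp add: field_simps power2_eq_square)
  moreover have "(v + w) \<bullet> (M *\<^sub>v (v + w)) =
      v \<bullet> (M *\<^sub>v v) + 2 * (v \<bullet> (M *\<^sub>v w)) + w \<bullet> (M *\<^sub>v w)"
    using symmetric_quad_lincomb[OF sy v w, of 1 1] by simp
  ultimately show ?thesis by (simp add: algebra_simps)
qed

text \<open>The identity form specializes the general results to ordinary Cauchy-Schwarz and to
  positivity of \<open>v \<bullet> v\<close>.\<close>

lemma pos_def_one: "pos_def d (1\<^sub>m d)"
  unfolding pos_def_def symmetric_def
proof (safe intro!: ballI)
  fix v :: "real vec" assume v: "v \<in> carrier_vec d" "v \<noteq> 0\<^sub>v d"
  then have "euclid_norm v \<noteq> 0" by (simp add: euclid_norm_eq_0_iff)
  then have "0 < (euclid_norm v)\<^sup>2" by simp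
  then show "0 < v \<bullet> (1\<^sub>m d *\<^sub>v v)" using v by (simp add: euclid_norm_power2)
qed auto

lemma scalar_prod_Cauchy_Schwarz:
  fixes v w :: "real vec"
  assumes "v \<in> carrier_vec d" "w \<in> carrier_vec d"
  shows "(v \<bullet> w)\<^sup>2 \<le> (v \<bullet> v) * (w \<bullet> w)"
  using pos_def_Cauchy_Schwarz[OF pos_def_one assms] assms by simp

lemma mult_mat_vec_bounded:
  fixes M :: "real mat"
  assumes M: "M \<in> carrier_mat k d"
  obtains C where "C > 0" "\<And>v. v \<in> carrier_vec d \<Longrightarrow> (M *\<^sub>v v) \<bullet> (M *\<^sub>v v) \<le> C * (v \<bullet> v)"
proof
  \<comment> \<open>This is the squared Frobenius norm, obtained from Cauchy-Schwarz on each row.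
    Adding 1 makes the constant positive even for a zero matrix.\<close>
  let ?C = "\<Sum>i<k. row M i \<bullet> row M i"
  have "0 \<le> ?C" by (intro sum_nonneg) (simp flip: euclid_norm_power2)
  then show "?C + 1 > 0" by simp
  fix v :: "real vec" assume v: "v \<in> carrier_vec d"
  have "(M *\<^sub>v v) \<bullet> (M *\<^sub>v v) = (\<Sum>i<k. (row M i \<bullet> v)\<^sup>2)"
    using M by (simp add: scalar_prod_def[of "M *\<^sub>v v"] power2_eq_square atLeast0LessThan)
  also have "\<dots> \<le> (\<Sum>i<k. (row M i \<bullet> row M i) * (v \<bullet> v))"
    using M v by (intro sum_mono scalar_prod_Cauchy_Schwarz[of _ d]) auto
  also have "\<dots> \<le> (?C + 1) * (v \<bullet> v)"
    by (simp add: sum_distrib_right distrib_right flip: euclid_norm_power2)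
  finally show "(M *\<^sub>v v) \<bullet> (M *\<^sub>v v) \<le> (?C + 1) * (v \<bullet> v)" .
qed

text \<open>Cauchy-Schwarz for \<open>v\<close> and \<open>M v\<close>, combined with the bound on
  \<open>M v\<close>, gives the constant \<open>sqrt C\<close> after comparing squares.\<close>

lemma pos_def_quad_le:
  assumes M: "pos_def d M"
  obtains C where "C > 0" "\<And>v. v \<in> carrier_vec d \<Longrightarrow> v \<bullet> (M *\<^sub>v v) \<le> C * (v \<bullet> v)"
proof -
  obtain C where C: "C > 0" "\<And>v. v \<in> carrier_vec d \<Longrightarrow> (M *\<^sub>v v) \<bullet> (M *\<^sub>v v) \<le> C * (v \<bullet> v)"
    using mult_mat_vec_bounded[OF pos_def_carrier[OF M]] by blast
  have "v \<bullet> (M *\<^sub>v v) \<le> sqrt C * (v \<bullet> v)" if v: "v \<in> carrier_vec d" for v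
  proof (rule power2_le_imp_le)
    have "(v \<bullet> (M *\<^sub>v v))\<^sup>2 \<le> (v \<bullet> v) * ((M *\<^sub>v v) \<bullet> (M *\<^sub>v v))"
      using v pos_def_carrier[OF M] by (intro scalar_prod_Cauchy_Schwarz[of _ d]) auto
    also have "\<dots> \<le> (v \<bullet> v) * (C * (v \<bullet> v))"
      using C(2)[OF v] by (intro mult_left_mono) (auto simp flip: euclid_norm_power2)
    also have "\<dots> = (sqrt C * (v \<bullet> v))\<^sup>2"
      using C(1) by (simp add: power_mult_distrib power2_eq_square[of "v \<bullet> v"])
    finally show "(v \<bullet> (M *\<^sub>v v))\<^sup>2 \<le> (sqrt C * (v \<bullet> v))\<^sup>2" .
    show "0 \<le> sqrt C * (v \<bullet> v)" using C(1) by (simp flip: euclid_norm_power2)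
  qed
  with C(1) show thesis by (intro that[of "sqrt C"]) auto
qed

text \<open>A nonzero kernel vector would make the form vanish, so the determinant is nonzero.
  Symmetry of the inverse comes from inserting \<open>M * R\<close> to the right of the transpose of
  \<open>R\<close> and using symmetry of \<open>M\<close>; positivity holds because the form of
  \<open>R\<close> at \<open>v\<close> is the form of \<open>M\<close> at
  \<open>R v\<close>.\<close>

lemma pos_def_inverse:
  assumes M: "pos_def d M"
  obtains R where "pos_def d R" "M * R = 1\<^sub>m d" "R * M = 1\<^sub>m d"
proof -
  note Mc = pos_def_carrier[OF M]
  have "det M \<noteq> 0"
  proof
    assume "det M = 0"
    then obtain v where "v \<in> carrier_vec d" "v \<noteq> 0\<^sub>v d" "M *\<^sub>v v = 0\<^sub>v d"
      using det_0_iff_vec_prod_zero[OF Mc] by blast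
    then show False using M by (force simp: pos_def_def)
  qed
  then have "M \<in> Units (ring_mat TYPE(real) d ())" by (rule det_non_zero_imp_unit[OF Mc])
  then obtain R where "mat_inverse M = Some R"
    using mat_inverse(1)[OF Mc] by fastforce
  then have R: "M * R = 1\<^sub>m d" "R * M = 1\<^sub>m d" "R \<in> carrier_mat d d"
    using mat_inverse(2)[OF Mc] by auto
  have "R\<^sup>T = R"
  proof -
    have Mt: "M\<^sup>T = M" using M by (simp add: pos_def_def symmetric_def)
    have "R\<^sup>T = R\<^sup>T * (M * R)" using R by simp
    also have "\<dots> = (R\<^sup>T * M\<^sup>T) * R" using R Mc Mt by (simp add: assoc_mult_mat[of _ d d _ d _ d])
    also have "R\<^sup>T * M\<^sup>T = (M * R)\<^sup>T" using transpose_mult[OF Mc R(3)] by simp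
    finally show ?thesis using R by simp
  qed
  moreover have "0 < v \<bullet> (R *\<^sub>v v)" if v: "v \<in> carrier_vec d" "v \<noteq> 0\<^sub>v d" for v
  proof -
    have MRv: "M *\<^sub>v (R *\<^sub>v v) = v"
      using R Mc v assoc_mult_mat_vec[of M d d R d v] by simp
    then have "R *\<^sub>v v \<noteq> 0\<^sub>v d" using v mult_mat_zero_vec[OF Mc] by metis
    then have "0 < (R *\<^sub>v v) \<bullet> (M *\<^sub>v (R *\<^sub>v v))" using M R v by (auto simp: pos_def_def)
    also have "\<dots> = v \<bullet> (R *\<^sub>v v)"
      unfolding MRv using R v by (intro comm_scalar_prod[of _ d]) auto
    finally show ?thesis .
  qed
  ultimately have "pos_def d R" using R by (auto simp: pos_def_def symmetric_def)
  with R show thesis using that by blast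
qed

text \<open>Cauchy--Schwarz for the inverse form replaces compactness of the unit sphere.\<close>

lemma pos_def_quad_ge:
  assumes M: "pos_def d M"
  obtains c where "c > 0" "\<And>v. v \<in> carrier_vec d \<Longrightarrow> c * (v \<bullet> v) \<le> v \<bullet> (M *\<^sub>v v)"
proof -
  obtain R where R: "pos_def d R" "M * R = 1\<^sub>m d" "R * M = 1\<^sub>m d"
    using pos_def_inverse[OF M] by blast
  obtain C where C: "C > 0" "\<And>v. v \<in> carrier_vec d \<Longrightarrow> v \<bullet> (R *\<^sub>v v) \<le> C * (v \<bullet> v)"
    using pos_def_quad_le[OF R(1)] by blast
  note Mc = pos_def_carrier[OF M] and Rc = pos_def_carrier[OF R(1)]
  have "(1 / C) * (v \<bullet> v) \<le> v \<bullet> (M *\<^sub>v v)" if v: "v \<in> carrier_vec d" for v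
  proof (cases "v = 0\<^sub>v d")
    case True
    then show ?thesis using Mc by auto
  next
    case False
    then have pos: "0 < v \<bullet> v" using pos_def_one[of d] v by (auto simp: pos_def_def)
    have Mv: "M *\<^sub>v v \<in> carrier_vec d" using Mc v by simp
    have RMv: "R *\<^sub>v (M *\<^sub>v v) = v"
      using R Mc Rc v assoc_mult_mat_vec[of R d d M d v] by simp
    \<comment> \<open>Cauchy-Schwarz for \<open>R\<close> is taken at \<open>v\<close> and
      \<open>M v\<close>, whose mixed term is \<open>v \<bullet> v\<close>. Bounding the first
      factor by \<open>C\<close> and cancelling \<open>v \<bullet> v\<close> leaves the constant
      \<open>1 / C\<close>.\<close>
    have "(v \<bullet> v)\<^sup>2 \<le> (v \<bullet> (R *\<^sub>v v)) * ((M *\<^sub>v v) \<bullet> v)"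
      using pos_def_Cauchy_Schwarz[OF R(1) v Mv] unfolding RMv .
    also have "(M *\<^sub>v v) \<bullet> v = v \<bullet> (M *\<^sub>v v)" using comm_scalar_prod[OF Mv v] .
    also have "(v \<bullet> (R *\<^sub>v v)) * (v \<bullet> (M *\<^sub>v v)) \<le> (C * (v \<bullet> v)) * (v \<bullet> (M *\<^sub>v v))"
      by (intro mult_right_mono C(2) pos_def_quad_nonneg[OF M] v)
    finally show ?thesis using pos C(1) by (simp add: power2_eq_square field_simps)
  qed
  with C(1) show thesis by (intro that[of "1 / C"]) auto
qed

section \<open>Lyapunov's direct method in discrete time\<close>

text \<open>The two quadratic bounds place each sublevel set of \<open>V\<close> between two balls.
  A trajectory that starts in a sublevel set inside the region of decay stays there, and
  \<open>V\<close> decreases geometrically along it.\<close>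

lemma quadratic_lyapunov_asymptotically_stable:
  assumes f: "f \<in> carrier_vec n \<rightarrow> carrier_vec n" and f0: "f (0\<^sub>v n) = 0\<^sub>v n"
    and c: "0 < a" "0 < b" and r: "0 \<le> r" "r < 1" and d: "0 < d"
    and lower: "\<And>v. v \<in> carrier_vec n \<Longrightarrow> a * (euclid_norm v)\<^sup>2 \<le> V v"
    and upper: "\<And>v. v \<in> carrier_vec n \<Longrightarrow> V v \<le> b * (euclid_norm v)\<^sup>2"
    and decay: "\<And>v. v \<in> carrier_vec n \<Longrightarrow> euclid_norm v < d \<Longrightarrow> V (f v) \<le> r * V v"
  shows "asymptotically_stable_equilibrium n f (0\<^sub>v n)"
proof -
  have iter: "(f ^^ t) v \<in> carrier_vec n" if "v \<in> carrier_vec n" for v t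
    using that f by (induction t) auto
  have Vnonneg: "0 \<le> V v" if "v \<in> carrier_vec n" for v
    using lower[OF that] c(1) by (smt (verit) mult_nonneg_nonneg zero_le_power2)
  have level: "euclid_norm v < e" if "v \<in> carrier_vec n" "V v < a * e\<^sup>2" "0 < e" for v e
  proof -
    have "a * (euclid_norm v)\<^sup>2 < a * e\<^sup>2" using lower[OF that(1)] that(2) by simp
    then show ?thesis using c(1) that(3) by (simp add: power_less_imp_less_base)
  qed
  \<comment> \<open>Converse of \<open>level\<close> at the price of shrinking the radius by
    \<open>sqrt (a / b)\<close>, the ratio forced by the two bounds on \<open>V\<close>.\<close>
  have start: "V v < a * e\<^sup>2"
    if v: "v \<in> carrier_vec n" and "euclid_norm v < e * sqrt (a / b)" and "0 < e" for v e
  proof -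
    have "(euclid_norm v)\<^sup>2 < (e * sqrt (a / b))\<^sup>2"
      using that by (intro power_strict_mono) auto
    also have "\<dots> = e\<^sup>2 * (a / b)" using c by (simp add: power_mult_distrib)
    finally have "b * (euclid_norm v)\<^sup>2 < a * e\<^sup>2" using c by (simp add: field_simps)
    then show ?thesis using upper[OF v] by simp
  qed
  \<comment> \<open>Decay is known only within radius \<open>d\<close>. The induction hypothesis
    itself keeps the iterate there: it bounds \<open>V\<close> by its initial value, hence by
    \<open>a * d\<^sup>2\<close>, and \<open>level\<close> applies.\<close>
  have geometric: "V ((f ^^ t) v) \<le> r ^ t * V v"
    if v: "v \<in> carrier_vec n" and small: "V v < a * d\<^sup>2" for v t
  proof (induction t)
    case (Suc t)
    have "r ^ t * V v \<le> 1 * V v"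
      using r Vnonneg[OF v] by (intro mult_right_mono power_le_one) auto
    then have "euclid_norm ((f ^^ t) v) < d"
      using Suc small iter[OF v] d by (intro level) auto
    then have "V ((f ^^ Suc t) v) \<le> r * V ((f ^^ t) v)" using decay iter[OF v] by simp
    also have "\<dots> \<le> r * (r ^ t * V v)" using Suc r(1) by (rule mult_left_mono)
    finally show ?case by (simp add: mult.assoc)
  qed simp
  have minus0: "v - 0\<^sub>v n = v" if "v \<in> carrier_vec n" for v :: "real vec"
    using that by auto
  have "lyapunov_stable n f (0\<^sub>v n)"
    unfolding lyapunov_stable_def
  proof (intro allI impI)
    fix e :: real assume e: "e > 0"
    \<comment> \<open>Radius \<open>g\<close> meets both demands: below \<open>d\<close> the decay
      applies, below \<open>e\<close> the target bound holds.\<close>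
    define g where "g = min d e"
    have g: "0 < g" "g \<le> d" "g \<le> e" using d e by (auto simp: g_def)
    have "euclid_norm ((f ^^ t) v - 0\<^sub>v n) < e"
      if v: "v \<in> carrier_vec n" and "euclid_norm (v - 0\<^sub>v n) < g * sqrt (a / b)" for v t
    proof -
      have Vg: "V v < a * g\<^sup>2" using start[OF v] that g by (simp add: minus0)
      also have "\<dots> \<le> a * d\<^sup>2" using g c by (simp add: power_mono)
      finally have "V ((f ^^ t) v) \<le> r ^ t * V v" by (rule geometric[OF v])
      also have "\<dots> \<le> 1 * V v"
        using r Vnonneg[OF v] by (intro mult_right_mono power_le_one) auto
      finally have "euclid_norm ((f ^^ t) v) < g"
        using Vg g iter[OF v] by (intro level) auto
      then show ?thesis using g iter[OF v] by (simp add: minus0)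
    qed
    moreover have "0 < g * sqrt (a / b)" using g c by simp
    ultimately show "\<exists>\<delta>>0. \<forall>v\<in>carrier_vec n. euclid_norm (v - 0\<^sub>v n) < \<delta> \<longrightarrow>
        (\<forall>t. euclid_norm ((f ^^ t) v - 0\<^sub>v n) < e)" by blast
  qed
  moreover have "locally_attractive n f (0\<^sub>v n)"
    unfolding locally_attractive_def
  proof (intro exI[of _ "d * sqrt (a / b)"] conjI ballI impI)
    show "0 < d * sqrt (a / b)" using d c by simp
    fix v :: "real vec"
    assume v: "v \<in> carrier_vec n" and "euclid_norm (v - 0\<^sub>v n) < d * sqrt (a / b)"
    then have Vd: "V v < a * d\<^sup>2" using start[OF v] d by (simp add: minus0)
    \<comment> \<open>\<open>V\<close> controls the squared norm, so the squares are squeezed by a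
      geometric sequence first and a square root is taken afterwards.\<close>
    have "(\<lambda>t. (euclid_norm ((f ^^ t) v))\<^sup>2) \<longlonglongrightarrow> 0"
    proof (rule tendsto_sandwich[of "\<lambda>_. 0"])
      show "\<forall>\<^sub>F t in sequentially. (euclid_norm ((f ^^ t) v))\<^sup>2 \<le> r ^ t * (V v / a)"
      proof (intro always_eventually allI)
        fix t
        have "a * (euclid_norm ((f ^^ t) v))\<^sup>2 \<le> r ^ t * V v"
          using lower[OF iter[OF v]] geometric[OF v Vd] by (rule order_trans)
        then show "(euclid_norm ((f ^^ t) v))\<^sup>2 \<le> r ^ t * (V v / a)"
          using c by (simp add: field_simps)
      qed
      show "(\<lambda>t. r ^ t * (V v / a)) \<longlonglongrightarrow> 0"
        using r by (intro tendsto_mult_left_zero LIMSEQ_realpow_zero) auto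
    qed auto
    then have "(\<lambda>t. sqrt ((euclid_norm ((f ^^ t) v))\<^sup>2)) \<longlonglongrightarrow> sqrt 0"
      by (rule tendsto_real_sqrt)
    then show "(\<lambda>t. euclid_norm ((f ^^ t) v - 0\<^sub>v n)) \<longlonglongrightarrow> 0"
      using iter[OF v] by (simp add: minus0)
  qed
  ultimately show ?thesis
    using f0 by (simp add: asymptotically_stable_equilibrium_def equilibrium_def)
qed

section \<open>Contraction of the linear part and its nonlinear perturbation\<close>

lemma small_state_tendsto_0D:
  assumes lim: "((\<lambda>v. euclid_norm (Q v) / euclid_norm v) \<longlongrightarrow> 0) (small_state n)"
    and Q0: "Q (0\<^sub>v n) = 0\<^sub>v k" and e: "0 < e"
  obtains d where "d > 0"
    "\<And>v. v \<in> carrier_vec n \<Longrightarrow> euclid_norm v < d \<Longrightarrow> euclid_norm (Q v) \<le> e * euclid_norm v"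
proof -
  have "\<forall>\<^sub>F v in small_state n. euclid_norm (Q v) / euclid_norm v < e"
    using order_tendstoD(2)[OF lim e] .
  then obtain d where d: "d > 0" "\<And>v. v \<in> carrier_vec n \<Longrightarrow> 0 < euclid_norm v \<Longrightarrow>
      euclid_norm v < d \<Longrightarrow> euclid_norm (Q v) / euclid_norm v < e"
    unfolding small_state_def eventually_inf_principal eventually_filtercomap
      eventually_at_right_field by blast
  have "euclid_norm (Q v) \<le> e * euclid_norm v"
    if v: "v \<in> carrier_vec n" "euclid_norm v < d" for v
  \<comment> \<open>The filter ignores the origin, so the limit says nothing there and
    \<open>Q0\<close> supplies the bound.\<close>
  proof (cases "euclid_norm v = 0")
    case True
    then have "euclid_norm (Q v) = 0"
      using Q0 v by (simp add: euclid_norm_eq_0_iff) (simp add: euclid_norm_def)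
    then show ?thesis using True by simp
  next
    case False
    then have "0 < euclid_norm v" using euclid_norm_nonneg[of v] by linarith
    then show ?thesis using d(2)[OF v(1) _ v(2)] by (simp add: field_simps)
  qed
  with d(1) show thesis using that by blast
qed

text \<open>The block form is evaluated at \<open>(R v, - R w)\<close> with \<open>w = W R v\<close>, where it equals
  \<open>v \<bullet> R v - w \<bullet> R w\<close>; this takes the place of two Schur complements.\<close>

lemma pos_def_block_contraction:
  assumes P: "P \<in> carrier_mat n n" and W: "W \<in> carrier_mat n n"
    and blk: "pos_def (n + n) (four_block_mat P W\<^sup>T W P)"
    and R: "pos_def n R" "P * R = 1\<^sub>m n" and Ppd: "pos_def n P"
  obtains r where "0 \<le> r" "r < 1" "\<And>v. v \<in> carrier_vec n \<Longrightarrow>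
    (W *\<^sub>v (R *\<^sub>v v)) \<bullet> (R *\<^sub>v (W *\<^sub>v (R *\<^sub>v v))) \<le> r * (v \<bullet> (R *\<^sub>v v))"
proof -
  note Rc = pos_def_carrier[OF R(1)]
  obtain c where c: "c > 0" "\<And>z. z \<in> carrier_vec (n + n) \<Longrightarrow>
      c * (z \<bullet> z) \<le> z \<bullet> (four_block_mat P W\<^sup>T W P *\<^sub>v z)"
    using pos_def_quad_ge[OF blk] by blast
  obtain C where C: "C > 0" "\<And>v. v \<in> carrier_vec n \<Longrightarrow> v \<bullet> (P *\<^sub>v v) \<le> C * (v \<bullet> v)"
    using pos_def_quad_le[OF Ppd] by blast
  have PR: "P *\<^sub>v (R *\<^sub>v v) = v" if "v \<in> carrier_vec n" for v
    using assoc_mult_mat_vec[OF P Rc that] R(2) that by simp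
  have decay: "w \<bullet> (R *\<^sub>v w) \<le> (1 - c / C) * (v \<bullet> (R *\<^sub>v v))"
    if v: "v \<in> carrier_vec n" and w: "w = W *\<^sub>v (R *\<^sub>v v)" for v w
  proof -
    define a where "a = R *\<^sub>v v"
    define b where "b = (- 1) \<cdot>\<^sub>v (R *\<^sub>v w)"
    have wc: "w \<in> carrier_vec n" using w W Rc v by simp
    have a: "a \<in> carrier_vec n" and b: "b \<in> carrier_vec n"
      using Rc v wc by (auto simp: a_def b_def)
    have Pa: "P *\<^sub>v a = v" and Wa: "W *\<^sub>v a = w" using PR v w by (auto simp: a_def)
    have Pb: "P *\<^sub>v b = (- 1) \<cdot>\<^sub>v w"
      using mult_mat_vec[OF P, of "R *\<^sub>v w" "- 1"] PR[OF wc] Rc wc by (simp add: b_def)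
    have av: "a \<bullet> v = v \<bullet> (R *\<^sub>v v)" using a v by (simp add: a_def comm_scalar_prod[of _ n])
    have bw: "b \<bullet> w = - (w \<bullet> (R *\<^sub>v w))"
      using Rc wc comm_scalar_prod[of "R *\<^sub>v w" n w] by (simp add: b_def)
    have Wb: "W\<^sup>T *\<^sub>v b \<in> carrier_vec n" using W b by simp
    \<comment> \<open>Only the \<open>a\<close> component of the coercivity bound is kept, since the
      form of \<open>P\<close> at \<open>a\<close> is \<open>v \<bullet> (R *\<^sub>v v)\<close> and
      is at most \<open>C\<close> times \<open>a \<bullet> a\<close>. This yields the factor
      \<open>1 - c / C\<close>.\<close>
    have "c * (a \<bullet> a) \<le> c * ((a @\<^sub>v b) \<bullet> (a @\<^sub>v b))"
      using c(1) a b euclid_norm_power2[of b]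
      by (simp add: scalar_prod_append[of _ n _ n] flip: euclid_norm_power2[of b])
    also have "\<dots> \<le> (a @\<^sub>v b) \<bullet> (four_block_mat P W\<^sup>T W P *\<^sub>v (a @\<^sub>v b))"
      using a b by (intro c(2)) auto
    also have "four_block_mat P W\<^sup>T W P *\<^sub>v (a @\<^sub>v b) =
        (P *\<^sub>v a + W\<^sup>T *\<^sub>v b) @\<^sub>v (W *\<^sub>v a + P *\<^sub>v b)"
      using P W a b by (intro four_block_mat_mult_vec[of _ n n _ n _ n]) auto
    \<comment> \<open>The choice of \<open>b\<close> makes \<open>P b = - w\<close>, which cancels
      the second block row; one mixed term \<open>b \<bullet> w\<close> survives from the
      first.\<close>
    also have "(a @\<^sub>v b) \<bullet> \<dots> = a \<bullet> (v + W\<^sup>T *\<^sub>v b) + b \<bullet> (w + (- 1) \<cdot>\<^sub>v w)"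
      unfolding Pa Wa Pb using a b v wc Wb by (intro scalar_prod_append[of _ n _ n]) auto
    also have "\<dots> = a \<bullet> v + a \<bullet> (W\<^sup>T *\<^sub>v b) + (b \<bullet> w - b \<bullet> w)"
      using a b v wc Wb by (simp add: scalar_prod_add_distrib[of _ n])
    also have "a \<bullet> (W\<^sup>T *\<^sub>v b) = b \<bullet> w"
      using transpose_vec_mult_scalar[OF W a b] comm_scalar_prod[OF a Wb] Wa by simp
    finally have "c * (a \<bullet> a) \<le> v \<bullet> (R *\<^sub>v v) - w \<bullet> (R *\<^sub>v w)" using av bw by simp
    moreover have "v \<bullet> (R *\<^sub>v v) \<le> C * (a \<bullet> a)" using C(2)[OF a] Pa av by simp
    then have "c / C * (v \<bullet> (R *\<^sub>v v)) \<le> c * (a \<bullet> a)"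
      using c(1) C(1) by (simp add: field_simps)
    ultimately show ?thesis by (simp add: algebra_simps)
  qed
  show thesis
  proof
    \<comment> \<open>The maximum with 0 supplies the nonnegative rate; it only weakens the bound
      because the form of \<open>R\<close> is nonnegative.\<close>
    show "0 \<le> max 0 (1 - c / C)" "max 0 (1 - c / C) < 1" using c(1) C(1) by auto
    fix v :: "real vec" assume v: "v \<in> carrier_vec n"
    have "(1 - c / C) * (v \<bullet> (R *\<^sub>v v)) \<le> max 0 (1 - c / C) * (v \<bullet> (R *\<^sub>v v))"
      by (intro mult_right_mono pos_def_quad_nonneg[OF R(1) v]) simp
    then show "(W *\<^sub>v (R *\<^sub>v v)) \<bullet> (R *\<^sub>v (W *\<^sub>v (R *\<^sub>v v)))
        \<le> max 0 (1 - c / C) * (v \<bullet> (R *\<^sub>v v))"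
      using decay[OF v refl] by linarith
  qed
qed

text \<open>The block form at \<open>v\<close> padded with zeros is the form of \<open>P\<close> at
  \<open>v\<close>.\<close>

lemma pos_def_block_diagonal:
  assumes P: "symmetric n P" and W: "W \<in> carrier_mat n n"
    and blk: "pos_def (n + n) (four_block_mat P W\<^sup>T W P)"
  shows "pos_def n P"
  unfolding pos_def_def
proof (intro conjI ballI impI P)
  fix v :: "real vec" assume v: "v \<in> carrier_vec n" "v \<noteq> 0\<^sub>v n"
  have Pc: "P \<in> carrier_mat n n" using P by (simp add: symmetric_def)
  have "v @\<^sub>v 0\<^sub>v n \<noteq> 0\<^sub>v n @\<^sub>v 0\<^sub>v n" using v by simp
  also have "0\<^sub>v n @\<^sub>v 0\<^sub>v n = (0\<^sub>v (n + n) :: real vec)" by auto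
  finally have "0 < (v @\<^sub>v 0\<^sub>v n) \<bullet> (four_block_mat P W\<^sup>T W P *\<^sub>v (v @\<^sub>v 0\<^sub>v n))"
    using blk v(1) by (auto simp: pos_def_def)
  also have "four_block_mat P W\<^sup>T W P *\<^sub>v (v @\<^sub>v 0\<^sub>v n) =
      (P *\<^sub>v v + W\<^sup>T *\<^sub>v 0\<^sub>v n) @\<^sub>v (W *\<^sub>v v + P *\<^sub>v 0\<^sub>v n)"
    using Pc W v(1) by (intro four_block_mat_mult_vec[of _ n n _ n _ n]) auto
  also have "(v @\<^sub>v 0\<^sub>v n) \<bullet> \<dots> =
      v \<bullet> (P *\<^sub>v v + W\<^sup>T *\<^sub>v 0\<^sub>v n) + 0\<^sub>v n \<bullet> (W *\<^sub>v v + P *\<^sub>v 0\<^sub>v n)"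
    using Pc W v(1) by (intro scalar_prod_append[of _ n _ n]) auto
  also have "W\<^sup>T *\<^sub>v 0\<^sub>v n = 0\<^sub>v n" using W by auto
  also have "0\<^sub>v n \<bullet> (W *\<^sub>v v + P *\<^sub>v 0\<^sub>v n) = 0" using Pc W v(1) by simp
  finally show "0 < v \<bullet> (P *\<^sub>v v)" using Pc v(1) by simp
qed

text \<open>The form of \<open>R\<close> is the Lyapunov function. Splitting
  \<open>M v + N Q v\<close> with weight \<open>s\<close> costs the linear part a little of its
  margin \<open>1 - r\<close>, and near the origin the nonlinear part costs a little more.\<close>

lemma contraction_perturbation_asymptotically_stable:
  assumes R: "pos_def n R" and r: "0 \<le> r" "r < 1"
    and M: "M \<in> carrier_mat n n" and N: "N \<in> carrier_mat n k"
    and contr: "\<And>v. v \<in> carrier_vec n \<Longrightarrow>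
      (M *\<^sub>v v) \<bullet> (R *\<^sub>v (M *\<^sub>v v)) \<le> r * (v \<bullet> (R *\<^sub>v v))"
    and Q: "Q \<in> carrier_vec n \<rightarrow> carrier_vec k" and Q0: "Q (0\<^sub>v n) = 0\<^sub>v k"
    and small: "((\<lambda>v. euclid_norm (Q v) / euclid_norm v) \<longlongrightarrow> 0) (small_state n)"
    and f: "\<And>v. v \<in> carrier_vec n \<Longrightarrow> f v = M *\<^sub>v v + N *\<^sub>v Q v"
  shows "asymptotically_stable_equilibrium n f (0\<^sub>v n)"
proof -
  obtain a where a: "a > 0" "\<And>v. v \<in> carrier_vec n \<Longrightarrow> a * (v \<bullet> v) \<le> v \<bullet> (R *\<^sub>v v)"
    using pos_def_quad_ge[OF R] by blast
  obtain b where b: "b > 0" "\<And>v. v \<in> carrier_vec n \<Longrightarrow> v \<bullet> (R *\<^sub>v v) \<le> b * (v \<bullet> v)"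
    using pos_def_quad_le[OF R] by blast
  obtain C where C: "C > 0" "\<And>v. v \<in> carrier_vec k \<Longrightarrow> (N *\<^sub>v v) \<bullet> (N *\<^sub>v v) \<le> C * (v \<bullet> v)"
    using mult_mat_vec_bounded[OF N] by blast
  \<comment> \<open>Half of the margin goes to the linear part:
    \<open>(1 + s) * r \<le> r + s = (1 + r) / 2\<close>.\<close>
  define s where "s = (1 - r) / 2"
  have s: "s > 0" using r by (simp add: s_def)
  \<comment> \<open>\<open>q\<close> collects the constants in the nonlinear term: if
    \<open>Q v\<close> has norm at most \<open>e\<close> times that of \<open>v\<close>, the term is
    at most \<open>q * e\<^sup>2\<close> times the Lyapunov function. The next choice of
    \<open>e\<close> makes this a quarter of the margin, for the total rate
    \<open>(3 + r) / 4\<close>.\<close>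
  define q where "q = (1 + 1 / s) * b * C / a"
  have q: "q > 0" using s a(1) b(1) C(1) by (simp add: q_def add_pos_pos)
  define e where "e = sqrt ((1 - r) / (4 * q))"
  have e: "e > 0" and qe: "q * e\<^sup>2 = (1 - r) / 4" using q r by (auto simp: e_def)
  obtain d where d: "d > 0" "\<And>v. v \<in> carrier_vec n \<Longrightarrow> euclid_norm v < d \<Longrightarrow>
      euclid_norm (Q v) \<le> e * euclid_norm v"
    using small_state_tendsto_0D[OF small Q0 e] by blast
  show ?thesis
  proof (rule quadratic_lyapunov_asymptotically_stable
      [where V = "\<lambda>v. v \<bullet> (R *\<^sub>v v)" and a = a and b = b and d = d])
    show "f \<in> carrier_vec n \<rightarrow> carrier_vec n" proof
      fix v :: "real vec" assume v: "v \<in> carrier_vec n"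
      then have "Q v \<in> carrier_vec k" using Q by auto
      then show "f v \<in> carrier_vec n" unfolding f[OF v] using M N v by simp
    qed
    show "f (0\<^sub>v n) = 0\<^sub>v n"
      using f[of "0\<^sub>v n"] Q0 M N by auto
    show "0 \<le> (3 + r) / 4" "(3 + r) / 4 < 1" using r by auto
    fix v :: "real vec" assume v: "v \<in> carrier_vec n" "euclid_norm v < d"
    let ?m = "M *\<^sub>v v" and ?g = "N *\<^sub>v Q v" and ?V = "v \<bullet> (R *\<^sub>v v)"
    have m: "?m \<in> carrier_vec n" and g: "?g \<in> carrier_vec n" and Qv: "Q v \<in> carrier_vec k"
      using M mult_mat_vec_carrier[OF N] Q v by auto
    have V: "0 \<le> ?V" by (rule pos_def_quad_nonneg[OF R v(1)])
    have "Q v \<bullet> Q v \<le> e\<^sup>2 * (v \<bullet> v)"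
      using power_mono[OF d(2)[OF v] euclid_norm_nonneg, of 2]
      by (simp add: power_mult_distrib euclid_norm_power2)
    also have "\<dots> \<le> e\<^sup>2 * (?V / a)"
      using a(2)[OF v(1)] a(1) by (intro mult_left_mono) (auto simp: field_simps)
    finally have Q_le: "Q v \<bullet> Q v \<le> e\<^sup>2 * (?V / a)" .
    have "?g \<bullet> (R *\<^sub>v ?g) \<le> b * (?g \<bullet> ?g)" by (rule b(2)[OF g])
    also have "\<dots> \<le> b * (C * (e\<^sup>2 * (?V / a)))"
      using C(2)[OF Qv] mult_left_mono[OF Q_le, of C] C(1) b(1) by (intro mult_left_mono) auto
    finally have "(1 + 1 / s) * (?g \<bullet> (R *\<^sub>v ?g)) \<le> (1 + 1 / s) * (b * (C * (e\<^sup>2 * (?V / a))))"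
      using s by (intro mult_left_mono) auto
    also have "\<dots> = q * e\<^sup>2 * ?V" by (simp add: q_def)
    finally have g_le: "(1 + 1 / s) * (?g \<bullet> (R *\<^sub>v ?g)) \<le> (1 - r) / 4 * ?V" unfolding qe .
    have "(1 + s) * (?m \<bullet> (R *\<^sub>v ?m)) \<le> (1 + s) * (r * ?V)"
      using s contr[OF v(1)] by (intro mult_left_mono) auto
    also have "\<dots> = ((1 + s) * r) * ?V" by simp
    also have "(1 + s) * r \<le> r + s * 1"
      using mult_left_mono[of r 1 s] s r by (simp add: distrib_right)
    then have "((1 + s) * r) * ?V \<le> (r + s * 1) * ?V" using V by (rule mult_right_mono)
    finally have m_le: "(1 + s) * (?m \<bullet> (R *\<^sub>v ?m)) \<le> (r + s) * ?V" by simp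
    have "f v \<bullet> (R *\<^sub>v f v) \<le> (1 + s) * (?m \<bullet> (R *\<^sub>v ?m)) + (1 + 1 / s) * (?g \<bullet> (R *\<^sub>v ?g))"
      unfolding f[OF v(1)] by (rule pos_def_quad_add_le[OF R m g s])
    also have "\<dots> \<le> (r + s) * ?V + (1 - r) / 4 * ?V" using m_le g_le by (rule add_mono)
    also have "\<dots> = (3 + r) / 4 * ?V" by (simp add: s_def field_simps)
    finally show "f v \<bullet> (R *\<^sub>v f v) \<le> (3 + r) / 4 * ?V" .
  qed (use a b d in \<open>auto simp: euclid_norm_power2\<close>)
qed

section \<open>The gain applied to a lifted state\<close>

lemma append_cols_mult_vec:
  assumes M: "M \<in> carrier_mat t p" and N: "N \<in> carrier_mat t q"
    and v: "v \<in> carrier_vec p" and w: "w \<in> carrier_vec q"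
  shows "append_cols M N *\<^sub>v (v @\<^sub>v w) = M *\<^sub>v v + N *\<^sub>v w"
proof -
  have "append_cols M N *\<^sub>v (v @\<^sub>v w) =
      (M *\<^sub>v v + N *\<^sub>v w) @\<^sub>v (0\<^sub>m 0 p *\<^sub>v v + 0\<^sub>m 0 q *\<^sub>v w)"
    using M N unfolding append_cols_def
    by (subst four_block_mat_mult_vec[OF M N _ _ v w, of _ 0]) auto
  also have "\<dots> = M *\<^sub>v v + N *\<^sub>v w" using M N v w by (intro eq_vecI) auto
  finally show ?thesis .
qed

text \<open>A one-sided inverse \<open>E\<close> already makes \<open>D\<close> a unit, so the
  option is not \<open>None\<close>. Cancelling \<open>D\<close> on a vector lets the gain be
  evaluated without computing the inverse.\<close>

lemma the_mat_inverse_mult_vec: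
  fixes D E :: "real mat"
  assumes D: "D \<in> carrier_mat d d" and E: "E \<in> carrier_mat d d" "D * E = 1\<^sub>m d"
    and w: "w \<in> carrier_vec d"
  shows "the (mat_inverse D) \<in> carrier_mat d d" and "the (mat_inverse D) *\<^sub>v (D *\<^sub>v w) = w"
proof -
  have "E * D = 1\<^sub>m d" using mat_mult_left_right_inverse[OF D E] .
  then have "D \<in> Units (ring_mat TYPE(real) d ())"
    using D E by (auto simp: Units_def ring_mat_def)
  then obtain I where I: "mat_inverse D = Some I"
    using mat_inverse(1)[OF D] by fastforce
  then have I': "I \<in> carrier_mat d d" "I * D = 1\<^sub>m d" using mat_inverse(2)[OF D I] by auto
  then show "the (mat_inverse D) \<in> carrier_mat d d"
    and "the (mat_inverse D) *\<^sub>v (D *\<^sub>v w) = w"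
    using I assoc_mult_mat_vec[OF I'(1) D w] w by auto
qed

text \<open>The block-diagonal matrix sends \<open>R v\<close> stacked on \<open>w\<close> to
  \<open>v\<close> stacked on \<open>w\<close>, so its inverse undoes this and the columns of
  \<open>Y1\<close> and \<open>G2\<close> are then combined.\<close>

lemma sdp_gain_mult_vec:
  assumes nS: "n \<le> S" and U0: "U0 \<in> carrier_mat m T"
    and Y1: "Y1 \<in> carrier_mat T n" and G2: "G2 \<in> carrier_mat T (S - n)"
    and P: "P \<in> carrier_mat n n" and R: "R \<in> carrier_mat n n" "P * R = 1\<^sub>m n"
    and v: "v \<in> carrier_vec n" and w: "w \<in> carrier_vec (S - n)"
  shows "sdp_gain n S U0 P Y1 G2 *\<^sub>v (v @\<^sub>v w) = U0 *\<^sub>v (Y1 *\<^sub>v (R *\<^sub>v v) + G2 *\<^sub>v w)"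
proof -
  let ?k = "S - n"
  define D where "D = four_block_mat P (0\<^sub>m n ?k) (0\<^sub>m ?k n) (1\<^sub>m ?k)"
  define E where "E = four_block_mat R (0\<^sub>m n ?k) (0\<^sub>m ?k n) (1\<^sub>m ?k)"
  let ?z = "(R *\<^sub>v v) @\<^sub>v w"
  have D: "D \<in> carrier_mat (n + ?k) (n + ?k)" and E: "E \<in> carrier_mat (n + ?k) (n + ?k)"
    using P R by (auto simp: D_def E_def)
  have "D * E = four_block_mat (P * R + 0\<^sub>m n ?k * 0\<^sub>m ?k n) (P * 0\<^sub>m n ?k + 0\<^sub>m n ?k * 1\<^sub>m ?k)
      (0\<^sub>m ?k n * R + 1\<^sub>m ?k * 0\<^sub>m ?k n) (0\<^sub>m ?k n * 0\<^sub>m n ?k + 1\<^sub>m ?k * 1\<^sub>m ?k)"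
    unfolding D_def E_def using P R by (intro mult_four_block_mat[of _ n n _ ?k _ ?k _ _ n _ ?k]) auto
  also have "\<dots> = 1\<^sub>m (n + ?k)"
    using P R by (simp add: four_block_one_mat)
  finally have DE: "D * E = 1\<^sub>m (n + ?k)" .
  have z: "?z \<in> carrier_vec (n + ?k)" using R v w by auto
  have Rv: "R *\<^sub>v v \<in> carrier_vec n" using R v by simp
  have "D *\<^sub>v ?z = P *\<^sub>v (R *\<^sub>v v) @\<^sub>v 1\<^sub>m ?k *\<^sub>v w"
    unfolding D_def by (rule mult_mat_vec_split[OF P _ Rv w]) simp
  also have "\<dots> = v @\<^sub>v w"
    using assoc_mult_mat_vec[OF P R(1) v] R(2) v w by simp
  finally have Dz: "D *\<^sub>v ?z = v @\<^sub>v w" .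
  note I = the_mat_inverse_mult_vec[OF D E DE z, unfolded Dz]
  have YG: "append_cols Y1 G2 \<in> carrier_mat T (n + ?k)"
    using four_block_carrier_mat[of Y1 T n "0\<^sub>m 0 ?k :: real mat" 0 ?k] Y1 G2
    by (auto simp: append_cols_def)
  have vw: "v @\<^sub>v w \<in> carrier_vec (n + ?k)" using v w by auto
  have "sdp_gain n S U0 P Y1 G2 *\<^sub>v (v @\<^sub>v w) =
      U0 *\<^sub>v (append_cols Y1 G2 *\<^sub>v (the (mat_inverse D) *\<^sub>v (v @\<^sub>v w)))"
    unfolding sdp_gain_def D_def[symmetric]
    using U0 YG I(1) vw
    by (simp add: assoc_mult_mat_vec[of _ m "n + ?k" _ "n + ?k"] assoc_mult_mat_vec[of _ m T _ "n + ?k"])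
  also have "\<dots> = U0 *\<^sub>v (append_cols Y1 G2 *\<^sub>v ?z)" unfolding I(2) ..
  also have "append_cols Y1 G2 *\<^sub>v ?z = Y1 *\<^sub>v (R *\<^sub>v v) + G2 *\<^sub>v w"
    by (rule append_cols_mult_vec[OF Y1 G2 Rv w])
  finally show ?thesis .
qed

section \<open>The data equation and the closed loop\<close>

lemma data_carriers:
  "data_X1 n T x \<in> carrier_mat n T" "data_U0 m T u \<in> carrier_mat m T"
  "data_Z0 S T Q x \<in> carrier_mat S T"
  by (auto simp: data_X1_def data_U0_def data_Z0_def)

text \<open>Column \<open>j\<close> of the identity is the dynamics at time \<open>j\<close>; the
  shift in \<open>data_X1\<close> matches the successor state.\<close>

lemma data_X1_eq:
  assumes A: "A \<in> carrier_mat n S" and B: "B \<in> carrier_mat n m" and nS: "n \<le> S"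
    and Q: "Q \<in> carrier_vec n \<rightarrow> carrier_vec (S - n)"
    and x: "\<And>k. k \<le> T \<Longrightarrow> x k \<in> carrier_vec n"
    and u: "\<And>k. k < T \<Longrightarrow> u k \<in> carrier_vec m"
    and data: "\<And>k. k < T \<Longrightarrow> x (k + 1) = open_loop A B Q (x k) (u k)"
  shows "data_X1 n T x = A * data_Z0 S T Q x + B * data_U0 m T u"
proof (rule eq_matI)
  fix i j assume "i < dim_row (A * data_Z0 S T Q x + B * data_U0 m T u)"
    and "j < dim_col (A * data_Z0 S T Q x + B * data_U0 m T u)"
  then have i: "i < n" and j: "j < T" using B by (auto simp: data_U0_def)
  have xj: "x j \<in> carrier_vec n" using x j by simp
  then have z: "lift_state Q (x j) \<in> carrier_vec S"
    using Q nS append_carrier_vec[of "x j" n "Q (x j)" "S - n"] by (auto simp: lift_state_def)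
  have "data_X1 n T x $$ (i, j) = x (j + 1) $ i"
    using i j by (simp add: data_X1_def mat_of_cols_index)
  also have "\<dots> = row A i \<bullet> lift_state Q (x j) + row B i \<bullet> u j"
    using i j A B by (simp add: data[OF j, simplified] open_loop_def)
  also have "\<dots> = (A * data_Z0 S T Q x + B * data_U0 m T u) $$ (i, j)"
    using i j A B z u[OF j] by (simp add: data_Z0_def data_U0_def col_mat_of_cols)
  finally show "data_X1 n T x $$ (i, j) = (A * data_Z0 S T Q x + B * data_U0 m T u) $$ (i, j)" .
qed (use A B in \<open>auto simp: data_X1_def data_U0_def\<close>)

text \<open>One vector of weights on the samples, \<open>Y1 R v + G2 Q v\<close>, is mapped by
  \<open>Z0\<close> to the lifted state and by \<open>U0\<close> to the control input. Hence
  \<open>A\<close> and \<open>B\<close> enter only through \<open>A * Z0 + B * U0\<close>, which is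
  \<open>X1\<close>.\<close>

lemma closed_loop_eq:
  assumes A: "A \<in> carrier_mat n S" and B: "B \<in> carrier_mat n m" and nS: "n \<le> S"
    and Q: "Q \<in> carrier_vec n \<rightarrow> carrier_vec (S - n)"
    and Z0: "Z0 \<in> carrier_mat S T" and U0: "U0 \<in> carrier_mat m T"
    and X1: "X1 = A * Z0 + B * U0"
    and feasible: "sdp_feasible n S T X1 Z0 P Y1 G2"
    and R: "R \<in> carrier_mat n n" "P * R = 1\<^sub>m n"
    and v: "v \<in> carrier_vec n"
  shows "closed_loop A B Q (sdp_gain n S U0 P Y1 G2) v =
    X1 * Y1 *\<^sub>v (R *\<^sub>v v) + X1 * G2 *\<^sub>v Q v"
proof -
  have P: "P \<in> carrier_mat n n" and Y1: "Y1 \<in> carrier_mat T n" and G2: "G2 \<in> carrier_mat T (S - n)"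
    and ZY: "Z0 * Y1 = P @\<^sub>r 0\<^sub>m (S - n) n" and ZG: "Z0 * G2 = 0\<^sub>m n (S - n) @\<^sub>r 1\<^sub>m (S - n)"
    using feasible by (auto simp: sdp_feasible_def symmetric_def)
  have X1c: "X1 \<in> carrier_mat n T" using A B Z0 U0 X1 by simp
  have Qv: "Q v \<in> carrier_vec (S - n)" using Q v by auto
  have Rv: "R *\<^sub>v v \<in> carrier_vec n" using R v by simp
  let ?a = "Y1 *\<^sub>v (R *\<^sub>v v)" and ?b = "G2 *\<^sub>v Q v"
  have a: "?a \<in> carrier_vec T" and b: "?b \<in> carrier_vec T" using Y1 G2 Rv Qv by auto
  have "Z0 *\<^sub>v ?a = P *\<^sub>v (R *\<^sub>v v) @\<^sub>v 0\<^sub>m (S - n) n *\<^sub>v (R *\<^sub>v v)"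
    using assoc_mult_mat_vec[OF Z0 Y1 Rv] mat_mult_append[OF P zero_carrier_mat Rv] ZY by simp
  also have "\<dots> = v @\<^sub>v 0\<^sub>v (S - n)"
    using assoc_mult_mat_vec[OF P R(1) v] R v Rv by simp
  finally have Za: "Z0 *\<^sub>v ?a = v @\<^sub>v 0\<^sub>v (S - n)" .
  have "Z0 *\<^sub>v ?b = 0\<^sub>m n (S - n) *\<^sub>v Q v @\<^sub>v 1\<^sub>m (S - n) *\<^sub>v Q v"
    using assoc_mult_mat_vec[OF Z0 G2 Qv] mat_mult_append[OF zero_carrier_mat one_carrier_mat Qv] ZG
    by simp
  also have "\<dots> = 0\<^sub>v n @\<^sub>v Q v" using Qv by simp
  finally have Zb: "Z0 *\<^sub>v ?b = 0\<^sub>v n @\<^sub>v Q v" .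
  have "Z0 *\<^sub>v (?a + ?b) = (v @\<^sub>v 0\<^sub>v (S - n)) + (0\<^sub>v n @\<^sub>v Q v)"
    using mult_add_distrib_mat_vec[OF Z0 a b] Za Zb by simp
  also have "\<dots> = lift_state Q v"
    using v Qv by (auto simp: lift_state_def)
  finally have Z: "Z0 *\<^sub>v (?a + ?b) = lift_state Q v" .
  have K: "sdp_gain n S U0 P Y1 G2 *\<^sub>v lift_state Q v = U0 *\<^sub>v (?a + ?b)"
    unfolding lift_state_def by (rule sdp_gain_mult_vec[OF nS U0 Y1 G2 P R v Qv])
  have ab: "?a + ?b \<in> carrier_vec T" using a b by simp
  have "closed_loop A B Q (sdp_gain n S U0 P Y1 G2) v =
      A *\<^sub>v (Z0 *\<^sub>v (?a + ?b)) + B *\<^sub>v (U0 *\<^sub>v (?a + ?b))"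
    unfolding closed_loop_def open_loop_def K Z ..
  also have "\<dots> = X1 *\<^sub>v (?a + ?b)"
    unfolding X1
    using add_mult_distrib_mat_vec[of "A * Z0" n T "B * U0", OF _ _ ab] A B Z0 U0 ab
    by (simp add: assoc_mult_mat_vec[OF A Z0 ab] assoc_mult_mat_vec[OF B U0 ab])
  also have "\<dots> = X1 * Y1 *\<^sub>v (R *\<^sub>v v) + X1 * G2 *\<^sub>v Q v"
    using mult_add_distrib_mat_vec[OF X1c a b] assoc_mult_mat_vec[OF X1c Y1 Rv]
      assoc_mult_mat_vec[OF X1c G2 Qv] by simp
  finally show ?thesis .
qed

text \<open>The limit in \<open>Q_small\<close> leaves the value of \<open>Q\<close> at the origin
  free; \<open>Q_zero\<close> fixes it and makes the origin an equilibrium.\<close>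

theorem theorem4:
  fixes n m S T :: nat
    and A B P1 Y1 G2 :: "real mat"
    and Q :: "real vec \<Rightarrow> real vec"
    and x u :: "nat \<Rightarrow> real vec"
  assumes dims: "0 < n" "0 < m" "0 < S" "0 < T" "n \<le> S"
    and A: "A \<in> carrier_mat n S"
    and B: "B \<in> carrier_mat n m"
    and Q: "Q \<in> carrier_vec n \<rightarrow> carrier_vec (S - n)"
    and Q_zero: "Q (0\<^sub>v n) = 0\<^sub>v (S - n)"
    and Q_small: "((\<lambda>v. euclid_norm (Q v) / euclid_norm v) \<longlongrightarrow> 0) (small_state n)"
    and x: "\<And>k. k \<le> T \<Longrightarrow> x k \<in> carrier_vec n"
    and u: "\<And>k. k < T \<Longrightarrow> u k \<in> carrier_vec m"
    and data: "\<And>k. k < T \<Longrightarrow> x (k + 1) = open_loop A B Q (x k) (u k)"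
    and feasible: "sdp_feasible n S T (data_X1 n T x) (data_Z0 S T Q x) P1 Y1 G2"
  shows "asymptotically_stable_equilibrium n
           (closed_loop A B Q (sdp_gain n S (data_U0 m T u) P1 Y1 G2)) (0\<^sub>v n)"
proof -
  let ?X = "data_X1 n T x" and ?Z = "data_Z0 S T Q x" and ?U = "data_U0 m T u"
  let ?W = "?X * Y1"
  have X1: "?X = A * ?Z + B * ?U"
    using A B dims(5) Q x u data by (rule data_X1_eq)
  have P: "symmetric n P1" and Y1: "Y1 \<in> carrier_mat T n" and G2: "G2 \<in> carrier_mat T (S - n)"
    and blk: "pos_def (n + n) (four_block_mat P1 ?W\<^sup>T ?W P1)"
    using feasible by (auto simp: sdp_feasible_def)
  have W: "?W \<in> carrier_mat n n" using data_carriers(1) Y1 by (rule mult_carrier_mat)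
  have N: "?X * G2 \<in> carrier_mat n (S - n)" using data_carriers(1) G2 by (rule mult_carrier_mat)
  have Ppd: "pos_def n P1" by (rule pos_def_block_diagonal[OF P W blk])
  obtain R where R: "pos_def n R" "P1 * R = 1\<^sub>m n" using pos_def_inverse[OF Ppd] by blast
  note Rc = pos_def_carrier[OF R(1)]
  obtain r where r: "0 \<le> r" "r < 1" "\<And>v. v \<in> carrier_vec n \<Longrightarrow>
      (?W *\<^sub>v (R *\<^sub>v v)) \<bullet> (R *\<^sub>v (?W *\<^sub>v (R *\<^sub>v v))) \<le> r * (v \<bullet> (R *\<^sub>v v))"
    using pos_def_block_contraction[OF pos_def_carrier[OF Ppd] W blk R Ppd] by blast
  \<comment> \<open>The perturbation result expects a single matrix for the linear part, here
    \<open>?W * R\<close>, while the contraction is stated for successive application.\<close>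
  have WR: "?W * R *\<^sub>v v = ?W *\<^sub>v (R *\<^sub>v v)" if "v \<in> carrier_vec n" for v
    using assoc_mult_mat_vec[OF W Rc that] .
  show ?thesis
  proof (rule contraction_perturbation_asymptotically_stable
      [OF R(1) r(1,2) mult_carrier_mat[OF W Rc] N _ Q Q_zero Q_small])
    fix v :: "real vec" assume v: "v \<in> carrier_vec n"
    show "(?W * R *\<^sub>v v) \<bullet> (R *\<^sub>v (?W * R *\<^sub>v v)) \<le> r * (v \<bullet> (R *\<^sub>v v))"
      unfolding WR[OF v] by (rule r(3)[OF v])
    show "closed_loop A B Q (sdp_gain n S ?U P1 Y1 G2) v = ?W * R *\<^sub>v v + ?X * G2 *\<^sub>v Q v"
      unfolding WR[OF v]
      by (rule closed_loop_eq[OF A B dims(5) Q data_carriers(3,2) X1 feasible Rc R(2) v])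
  qed
qed

end
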